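(* Let $X$ be a compact Hausdorff space and let $\mathbb{K}=\mathbb{R}$ or $\mathbb{K}=\mathbb{C}$. Then $$\operatorname{bsr} C(X,\mathbb{K})=\operatorname{tsr} C(X,\mathbb{K})=\operatorname{nor} C(X,\mathbb{K}).$$
   Context: $C(X,\mathbb{K})$ is the algebra of continuous $\mathbb{K}$-valued functions on $X$, with the supremum norm $\|\cdot\|_\infty$ and the induced topology. For a commutative unital ring $R$ and an integer $n\ge 1$, let $U_n(R)=\{(f_1,\dots,f_n)\in R^n:\ \sum_{j=1}^n Rf_j=R\}$ be the set of invertible $n$-tuples. For $\boldsymbol f\in R^n$, $\boldsymbol x\in R^n$ and $g\in R$, $\boldsymbol f+\boldsymbol x\,g$ means $(f_1+x_1g,\dots,f_n+x_ng)$. The following ranks take values in $\{1,2,3,\dots\}\cup\{\infty\}$; each is the smallest integer $n\ge 1$ with the stated property, and $\infty$ if there is no such $n$. - Bass stable rank $\operatorname{bsr}R$: for every $(\boldsymbol f,g)\in U_{n+1}(R)$ there is $\boldsymbol x\in R^n$ with $\boldsymbol f+\boldsymbol x\,g\in U_n(R)$. - Topological stable rank $\operatorname{tsr}R$ ($R$ carrying a topology): $U_n(R)$ is dense in $R^n$. - Norm-one rank $\operatorname{nor}A$ ($A=(A,\|\cdot\|)$ a commutative unital normed algebra): for every $(\boldsymbol f,g)\in U_{n+1}(A)$ there is $\boldsymbol c=(c_1,\dots,c_n)\in A^n$ with $\|c_j\|=1$ for all $j$ and $\boldsymbol f+\boldsymbol c\,g\in U_n(A)$. *)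

theory Defs
  imports "HOL-Analysis.Analysis"
begin

section \<open>The algebra of bounded continuous functions\<close>

text \<open>
  The library makes \<^typ>\<open>'a \<Rightarrow>\<^sub>C 'b\<close> a normed vector space under the supremum norm; here it also
  receives its pointwise product. On a compact space every continuous function is bounded (lemma
  \<open>bcontfun_compact\<close> below), so that \<open>'a \<Rightarrow>\<^sub>C real\<close> and \<open>'a \<Rightarrow>\<^sub>C complex\<close> are then the full
  algebras of continuous functions.
\<close>

lemma times_cont: "f \<in> bcontfun \<Longrightarrow> g \<in> bcontfun \<Longrightarrow> (\<lambda>x. f x * g x) \<in> bcontfun"
  for f g :: "'a::topological_space \<Rightarrow> 'b::real_normed_algebra"
proof -
  assume f: "f \<in> bcontfun" and g: "g \<in> bcontfun"
  obtain B C where B: "\<And>x. norm (f x) \<le> B" and C: "\<And>x. norm (g x) \<le> C"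
    using f g unfolding bcontfun_def bounded_iff by auto
  have B0: "0 \<le> B"
    using B[of undefined] norm_ge_zero order_trans by blast
  show ?thesis
  proof (rule bcontfun_normI)
    show "continuous_on UNIV (\<lambda>x. f x * g x)"
      using f g by (auto simp: bcontfun_def intro!: continuous_intros)
    show "norm (f x * g x) \<le> B * C" for x
      by (rule order_trans[OF norm_mult_ineq]) (intro mult_mono B C B0 norm_ge_zero)
  qed
qed

instantiation bcontfun :: (topological_space, real_normed_field) comm_ring_1
begin

context includes bcontfun.lifting
begin

lift_definition times_bcontfun :: "('a \<Rightarrow>\<^sub>C 'b) \<Rightarrow> ('a \<Rightarrow>\<^sub>C 'b) \<Rightarrow> 'a \<Rightarrow>\<^sub>C 'b" is "\<lambda>f g x. f x * g x"
  by (rule times_cont)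

lift_definition one_bcontfun :: "'a \<Rightarrow>\<^sub>C 'b" is "\<lambda>_. 1"
  by (rule const_bcontfun)

end

lemmas [simp] = times_bcontfun.rep_eq one_bcontfun.rep_eq

instance
proof
  show "(0 :: 'a \<Rightarrow>\<^sub>C 'b) \<noteq> 1"
    by (metis one_bcontfun.rep_eq zero_bcontfun.rep_eq zero_neq_one)
qed (auto intro!: bcontfun_eqI simp: algebra_simps)

end

instance bcontfun :: (topological_space, real_normed_field) real_normed_algebra_1
proof
  fix a :: real and f g :: "'a \<Rightarrow>\<^sub>C 'b"
  show "a *\<^sub>R f * g = a *\<^sub>R (f * g)" "f * a *\<^sub>R g = a *\<^sub>R (f * g)"
    by (auto intro!: bcontfun_eqI)
  show "norm (f * g) \<le> norm f * norm g"
    by (rule norm_bound) (auto simp: norm_mult intro!: mult_mono norm_bounded)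
  show "norm (1 :: 'a \<Rightarrow>\<^sub>C 'b) = 1"
  proof (rule antisym)
    show "norm (1 :: 'a \<Rightarrow>\<^sub>C 'b) \<le> 1"
      by (rule norm_bound) simp
    show "1 \<le> norm (1 :: 'a \<Rightarrow>\<^sub>C 'b)"
      using norm_bounded[of "1 :: 'a \<Rightarrow>\<^sub>C 'b" undefined] by simp
  qed
qed

lemma bcontfun_compact:
  assumes "compact (UNIV :: 'a::topological_space set)"
  shows "(bcontfun :: ('a \<Rightarrow> 'b::metric_space) set) = {f. continuous_on UNIV f}"
  using assms by (auto simp: bcontfun_def intro: compact_imp_bounded compact_continuous_image)

lemma norm_bcontfun_eq_SUP:
  fixes f :: "'a::topological_space \<Rightarrow>\<^sub>C 'b::real_normed_vector"
  shows "norm f = (SUP x. norm (apply_bcontfun f x))"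
  by (simp add: norm_bcontfun_def dist_bcontfun.rep_eq)


section \<open>Stable ranks\<close>

text \<open>
  The power \<open>R\<^sup>n\<close> consists of the functions on \<open>{..<n}\<close>, extended by \<^const>\<open>undefined\<close>. This is the
  carrier of the product topology over the index set \<open>{..<n}\<close>. The tuple \<open>(\<^bold>f, g)\<close> of length
  \<open>n + 1\<close> is \<open>f(n := g)\<close>.
\<close>

definition tuples :: "nat \<Rightarrow> (nat \<Rightarrow> 'r) set" where
  "tuples n = {..<n} \<rightarrow>\<^sub>E UNIV"

definition inv_tuples :: "nat \<Rightarrow> (nat \<Rightarrow> 'r::comm_ring_1) set" where
  "inv_tuples n = {f \<in> tuples n. {\<Sum>j<n. r j * f j | r. r \<in> tuples n} = UNIV}"

definition add_mult_tuple :: "nat \<Rightarrow> (nat \<Rightarrow> 'r::comm_ring_1) \<Rightarrow> (nat \<Rightarrow> 'r) \<Rightarrow> 'r \<Rightarrow> nat \<Rightarrow> 'r" where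
  "add_mult_tuple n f x g = (\<lambda>j\<in>{..<n}. f j + x j * g)"

definition least_rank :: "(nat \<Rightarrow> bool) \<Rightarrow> enat" where
  "least_rank P = (if \<exists>n\<ge>1. P n then enat (LEAST n. n \<ge> 1 \<and> P n) else \<infinity>)"

definition bsr :: "'r::comm_ring_1 itself \<Rightarrow> enat" where
  "bsr R = least_rank (\<lambda>n. \<forall>f \<in> tuples n. \<forall>g::'r. f(n := g) \<in> inv_tuples (n + 1) \<longrightarrow>
     (\<exists>x \<in> tuples n. add_mult_tuple n f x g \<in> inv_tuples n))"

definition tsr :: "'r::{comm_ring_1, topological_space} itself \<Rightarrow> enat" where
  "tsr R = least_rank (\<lambda>n.
     product_topology (\<lambda>_. euclidean) {..<n} closure_of (inv_tuples n :: (nat \<Rightarrow> 'r) set) = tuples n)"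

definition nor :: "'r::{comm_ring_1, real_normed_algebra} itself \<Rightarrow> enat" where
  "nor R = least_rank (\<lambda>n. \<forall>f \<in> tuples n. \<forall>g::'r. f(n := g) \<in> inv_tuples (n + 1) \<longrightarrow>
     (\<exists>c \<in> tuples n. (\<forall>j<n. norm (c j) = 1) \<and> add_mult_tuple n f c g \<in> inv_tuples n))"

end

theory Submission
  imports Defs
begin

text \<open>
  On a compact space a tuple is invertible iff its entries have no common zero. Write \<open>N f\<close> for the
  sum of the \<open>\<bar>f\<^sub>j\<bar>\<close>. The three defining properties are equivalent for each \<open>n\<close>.

  A solution of the Bass problem for \<open>g = max 0 (\<epsilon> - N f)\<close> is a zero-free tuple \<open>h\<close> that agrees with \<open>f\<close>
  where \<open>N f \<ge> \<epsilon>\<close>; the rescaled tuple \<open>h \<cdot> max \<epsilon> (N f) / N h\<close> is zero-free and close to \<open>f\<close>.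

  Conversely, if zero-free tuples are dense, a zero-free \<open>u\<close> near \<open>f\<close> gives a small \<open>x\<close>, equal to
  \<open>(u - f) / g\<close> off a neighbourhood of the zeros of \<open>g\<close>, such that \<open>f + x g\<close> is zero-free. If \<open>g\<close> has a
  zero, \<open>x\<close> can be changed to the constant \<open>1\<close> there without creating zeros of \<open>f + x g\<close>. If
  \<open>g\<close> is invertible, adding \<open>s\<^sub>j u\<^sub>j / g\<close> to \<open>x\<^sub>j\<close> multiplies \<open>u\<^sub>j = f\<^sub>j + x\<^sub>j g\<close> by \<open>1 + s\<^sub>j\<close>, and a
  suitable \<open>s\<^sub>j \<ge> 0\<close> makes the norm equal to \<open>1\<close>.
\<close>

section \<open>Preliminaries on ranks and bounded continuous functions\<close>

lemma least_rank_cong: "(\<And>n. P n \<longleftrightarrow> Q n) \<Longrightarrow> least_rank P = least_rank Q"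
  by (simp add: least_rank_def)

lemma apply_Bcontfun_compact:
  fixes f :: "'a::topological_space \<Rightarrow> 'b::metric_space"
  assumes "compact (UNIV :: 'a set)" "continuous_on UNIV f"
  shows "apply_bcontfun (Bcontfun f) = f"
  using assms by (simp add: Bcontfun_inverse bcontfun_compact)

lemma continuous_on_apply_bcontfun [continuous_intros]:
  "continuous_on S (apply_bcontfun f)"
  using apply_bcontfun[of f] by (auto simp: bcontfun_def intro: continuous_on_subset)

lemma apply_bcontfun_sum:
  "apply_bcontfun (sum f A) x = (\<Sum>i\<in>A. apply_bcontfun (f i) x)"
  for f :: "_ \<Rightarrow> 'a::topological_space \<Rightarrow>\<^sub>C 'b::real_normed_vector"
  by (induction A rule: infinite_finite_induct) auto

lemma positive_continuous_bounded_below: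
  fixes f :: "'a::topological_space \<Rightarrow> real"
  assumes "compact (UNIV :: 'a set)" "continuous_on UNIV f" "\<And>x. 0 < f x"
  obtains m where "0 < m" "\<And>x. m \<le> f x"
  using continuous_attains_inf[OF assms(1) _ assms(2)] assms(3) by auto

section \<open>Invertible tuples as zero-free tuples\<close>

text \<open>Multiplying a representation of \<open>1\<close> by \<open>y\<close> represents
  \<open>y\<close>. Only the coefficients below \<open>n\<close> enter the sum, so \<open>r\<close>
  may be any function here; restricting it returns to \<open>tuples n\<close>.\<close>

lemma inv_tuples_iff:
  fixes f :: "nat \<Rightarrow> 'r::comm_ring_1"
  shows "f \<in> inv_tuples n \<longleftrightarrow> f \<in> tuples n \<and> (\<exists>r. (\<Sum>j<n. r j * f j) = 1)"
proof -
  have "\<exists>r. y = (\<Sum>j<n. r j * f j) \<and> r \<in> tuples n" if "(\<Sum>j<n. s j * f j) = 1" for s y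
  proof (intro exI conjI)
    show "(\<lambda>j\<in>{..<n}. y * s j) \<in> tuples n"
      by (simp add: tuples_def)
    show "y = (\<Sum>j<n. (\<lambda>j\<in>{..<n}. y * s j) j * f j)"
      using that by (simp add: mult.assoc flip: sum_distrib_left)
  qed
  moreover have "\<exists>r. (\<Sum>j<n. r j * f j) = 1"
    if "{\<Sum>j<n. r j * f j | r. r \<in> tuples n} = UNIV"
  proof -
    have "1 \<in> {\<Sum>j<n. r j * f j | r. r \<in> tuples n}"
      using that by simp
    then show ?thesis
      by (auto intro: sym)
  qed
  ultimately show ?thesis
    unfolding inv_tuples_def by blast
qed

text \<open>
  A substitute for complex conjugation that makes sense in every normed field; at \<open>0\<close> it takes the
  value \<open>0\<close> because \<open>inverse 0 = 0\<close>.
\<close>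

definition normed_conj :: "'b::real_normed_field \<Rightarrow> 'b" where
  "normed_conj z = (norm z)\<^sup>2 *\<^sub>R inverse z"

lemma norm_normed_conj [simp]: "norm (normed_conj z) = norm z"
  by (cases "z = 0") (simp_all add: normed_conj_def norm_inverse power2_eq_square)

lemma normed_conj_mult: "normed_conj z * z = of_real ((norm z)\<^sup>2)"
  by (cases "z = 0") (simp_all add: normed_conj_def scaleR_conv_of_real)

text \<open>Only the origin needs care: there the map tends to \<open>0\<close> because it preserves
  norms.\<close>

lemma continuous_normed_conj: "continuous_on UNIV (normed_conj :: 'b::real_normed_field \<Rightarrow> 'b)"
proof -
  have "isCont normed_conj z" for z :: 'b
  proof (cases "z = 0")
    case True
    have "(normed_conj \<longlongrightarrow> 0) (at (0::'b))"
      by (rule tendsto_norm_zero_cancel) (auto intro!: tendsto_eq_intros)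
    then show ?thesis
      using True by (simp add: isCont_def) (simp add: normed_conj_def)
  next
    case False
    then show ?thesis
      unfolding normed_conj_def by (intro continuous_intros) auto
  qed
  then show ?thesis
    by (simp add: continuous_at_imp_continuous_on)
qed

lemmas continuous_on_normed_conj [continuous_intros] =
  continuous_on_compose2[OF continuous_normed_conj _ subset_UNIV]

text \<open>A common zero of the entries would be a zero of \<open>1\<close>. Conversely, without
  common zeros the sum \<open>S\<close> of the squared norms is positive, and the functions
  \<open>normed_conj (f j) / S\<close> are coefficients that represent \<open>1\<close>; compactness
  makes them bounded.\<close>

lemma inv_tuples_bcontfun_iff:
  fixes f :: "nat \<Rightarrow> 'a::topological_space \<Rightarrow>\<^sub>C 'b::real_normed_field"
  assumes "compact (UNIV :: 'a set)"
  shows "f \<in> inv_tuples n \<longleftrightarrow> f \<in> tuples n \<and> (\<forall>x. \<exists>j<n. apply_bcontfun (f j) x \<noteq> 0)"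
proof -
  have "\<exists>j<n. apply_bcontfun (f j) x \<noteq> 0" if "(\<Sum>j<n. r j * f j) = 1" for r x
  proof (rule ccontr)
    assume "\<not> ?thesis"
    then have "apply_bcontfun (\<Sum>j<n. r j * f j) x = 0"
      by (simp add: apply_bcontfun_sum)
    then show False
      using that by simp
  qed
  moreover have "\<exists>r. (\<Sum>j<n. r j * f j) = 1" if nz: "\<forall>x. \<exists>j<n. apply_bcontfun (f j) x \<noteq> 0"
  proof -
    define S where "S x = (\<Sum>j<n. (norm (apply_bcontfun (f j) x))\<^sup>2)" for x
    have S: "0 < S x" for x
    proof -
      obtain j where "j < n" "apply_bcontfun (f j) x \<noteq> 0"
        using nz by blast
      then show ?thesis
        unfolding S_def by (intro sum_pos2[where i = j]) auto
    qed
    define r where "r j = Bcontfun (\<lambda>x. inverse (S x) *\<^sub>R normed_conj (apply_bcontfun (f j) x))" for j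
    have "S x \<noteq> 0" for x
      using S[of x] by simp
    then have r: "apply_bcontfun (r j) x = inverse (S x) *\<^sub>R normed_conj (apply_bcontfun (f j) x)" for j x
      unfolding r_def S_def
      by (subst apply_Bcontfun_compact[OF assms]) (auto intro!: continuous_intros)
    have "apply_bcontfun (\<Sum>j<n. r j * f j) x = apply_bcontfun 1 x" for x
    proof -
      have "apply_bcontfun (\<Sum>j<n. r j * f j) x = inverse (S x) *\<^sub>R of_real (S x)"
        by (simp add: apply_bcontfun_sum r normed_conj_mult S_def scaleR_sum_right del: of_real_power)
      then show ?thesis
        using S[of x] by (simp add: scaleR_conv_of_real)
    qed
    then show ?thesis
      by (blast intro: bcontfun_eqI)
  qed
  ultimately show ?thesis
    by (auto simp: inv_tuples_iff)
qed

lemma inv_tuples_Suc_bcontfun_iff: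
  fixes f :: "nat \<Rightarrow> 'a::topological_space \<Rightarrow>\<^sub>C 'b::real_normed_field"
  assumes "compact (UNIV :: 'a set)" "f \<in> tuples n"
  shows "f(n := g) \<in> inv_tuples (n + 1) \<longleftrightarrow>
    (\<forall>x. (\<exists>j<n. apply_bcontfun (f j) x \<noteq> 0) \<or> apply_bcontfun g x \<noteq> 0)"
proof -
  have "f(n := g) \<in> tuples (n + 1)"
    using assms(2) by (auto simp: tuples_def PiE_def extensional_def)
  then show ?thesis
    by (auto simp: inv_tuples_bcontfun_iff[OF assms(1)] less_Suc_eq)
qed

section \<open>Density in the product topology\<close>

text \<open>Only finitely many coordinates occur, so the radii of balls inside a basic open box have
  a positive minimum.\<close>

lemma closure_of_tuples_eq_iff:
  fixes S :: "(nat \<Rightarrow> 'r::metric_space) set"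
  assumes "S \<subseteq> tuples n"
  shows "product_topology (\<lambda>_. euclidean) {..<n} closure_of S = tuples n \<longleftrightarrow>
    (\<forall>f\<in>tuples n. \<forall>e>0. \<exists>u\<in>S. \<forall>j<n. dist (u j) (f j) < e)" (is "?T closure_of S = _ \<longleftrightarrow> ?R")
proof
  assume cl: "?T closure_of S = tuples n"
  show ?R
  proof (intro ballI allI impI)
    fix f :: "nat \<Rightarrow> 'r" and e :: real
    assume f: "f \<in> tuples n" and e: "0 < e"
    let ?B = "PiE {..<n} (\<lambda>j. ball (f j) e)"
    have "openin ?T ?B"
      by (simp add: openin_PiE_gen)
    moreover have "f \<in> ?B"
      using f e by (auto simp: tuples_def PiE_def)
    moreover have "f \<in> ?T closure_of S"
      using f cl by simp
    ultimately obtain u where "u \<in> S" "u \<in> ?B"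
      unfolding in_closure_of by blast
    then show "\<exists>u\<in>S. \<forall>j<n. dist (u j) (f j) < e"
      by (intro bexI[of _ u]) (auto simp: PiE_def Pi_def dist_commute)
  qed
next
  assume R: ?R
  have top: "topspace ?T = tuples n"
    by (simp add: tuples_def)
  have "f \<in> ?T closure_of S" if f: "f \<in> tuples n" for f
    unfolding in_closure_of top
  proof (intro conjI f allI impI)
    fix W
    assume "f \<in> W \<and> openin ?T W"
    then obtain V where V: "\<forall>j\<in>{..<n}. openin euclidean (V j)" "f \<in> PiE {..<n} V" "PiE {..<n} V \<subseteq> W"
      unfolding openin_product_topology_alt by blast
    have "\<exists>e>0. ball (f j) e \<subseteq> V j" if "j < n" for j
    proof -
      have "open (V j)" "f j \<in> V j"
        using V(1,2) that by auto
      then show ?thesis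
        by (meson openE)
    qed
    then obtain e where e: "\<And>j. j < n \<Longrightarrow> 0 < e j" "\<And>j. j < n \<Longrightarrow> ball (f j) (e j) \<subseteq> V j"
      by metis
    \<comment> \<open>The extra element \<open>1\<close> keeps the minimum meaningful for
      \<open>n = 0\<close>.\<close>
    define d where "d = Min (insert 1 (e ` {..<n}))"
    have d: "0 < d" "\<And>j. j < n \<Longrightarrow> d \<le> e j"
      using e(1) by (auto simp: d_def)
    obtain u where u: "u \<in> S" "\<And>j. j < n \<Longrightarrow> dist (u j) (f j) < d"
      using R f d(1) by blast
    have "u j \<in> V j" if "j < n" for j
      using e(2)[OF that] u(2)[OF that] d(2)[OF that] by (force simp: dist_commute)
    then have "u \<in> PiE {..<n} V"
      using u(1) assms by (auto simp: tuples_def PiE_def)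
    then show "\<exists>y. y \<in> S \<and> y \<in> W"
      using u(1) V(3) by blast
  qed
  then show "?T closure_of S = tuples n"
    using closure_of_subset_topspace[of ?T S] top by blast
qed

section \<open>From the Bass property to density and on to norm one\<close>

text \<open>Intermediate value theorem: the norm is below 1 at \<open>s = 0\<close> and at least 1
  at \<open>s = b\<close>, where the added vector has norm 2. The sign of \<open>s\<close> matters
  later, when \<open>1 + s\<close> has to be nonzero.\<close>

lemma ex_scale_norm_eq_one:
  fixes x w :: "'c::real_normed_vector"
  assumes "norm x < 1" "w \<noteq> 0"
  shows "\<exists>s\<ge>0. norm (x + s *\<^sub>R w) = 1"
proof -
  define b where "b = 2 / norm w"
  have "norm (b *\<^sub>R w) = 2"
    using assms by (simp add: b_def)
  then have "1 \<le> norm (x + b *\<^sub>R w)"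
    using norm_triangle_ineq4[of "x + b *\<^sub>R w" x] assms(1) by simp
  moreover have "continuous_on {0..b} (\<lambda>s. norm (x + s *\<^sub>R w))"
    by (intro continuous_intros)
  ultimately show ?thesis
    using IVT'[of "\<lambda>s. norm (x + s *\<^sub>R w)" 0 1 b] assms(1) by (auto simp: b_def)
qed

lemma bass_imp_dense:
  fixes f :: "nat \<Rightarrow> 'a::topological_space \<Rightarrow>\<^sub>C 'b::real_normed_field"
  assumes compact: "compact (UNIV :: 'a set)"
    and bass: "\<forall>f \<in> tuples n. \<forall>g::'a \<Rightarrow>\<^sub>C 'b. f(n := g) \<in> inv_tuples (n + 1) \<longrightarrow>
     (\<exists>x \<in> tuples n. add_mult_tuple n f x g \<in> inv_tuples n)"
    and f: "f \<in> tuples n" and e: "0 < e"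
  shows "\<exists>u\<in>inv_tuples n. \<forall>j<n. dist (u j) (f j) < e"
proof -
  \<comment> \<open>The approximation error will be at most \<open>2 * d\<close>, which is less than
    \<open>e\<close>.\<close>
  define d where "d = e / 3"
  have d: "0 < d"
    using e by (simp add: d_def)
  define N where "N x = (\<Sum>j<n. norm (apply_bcontfun (f j) x))" for x
  have contN: "continuous_on UNIV N"
    unfolding N_def by (intro continuous_intros)
  define g :: "'a \<Rightarrow>\<^sub>C 'b" where "g = Bcontfun (\<lambda>x. of_real (max 0 (d - N x)))"
  have g: "apply_bcontfun g x = of_real (max 0 (d - N x))" for x
    unfolding g_def by (subst apply_Bcontfun_compact[OF compact]) (auto intro!: continuous_intros contN)
  have "(\<exists>j<n. apply_bcontfun (f j) x \<noteq> 0) \<or> apply_bcontfun g x \<noteq> 0" for x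
  proof (rule ccontr)
    assume *: "\<not> ?thesis"
    then have "N x = 0"
      by (auto simp: N_def)
    then show False
      using * d by (simp add: g)
  qed
  then obtain y where y: "add_mult_tuple n f y g \<in> inv_tuples n"
    using bass f inv_tuples_Suc_bcontfun_iff[OF compact f] by blast
  define h where "h j = f j + y j * g" for j
  define M where "M x = (\<Sum>j<n. norm (apply_bcontfun (h j) x))" for x
  have h_nz: "\<exists>j<n. apply_bcontfun (h j) x \<noteq> 0" for x
  proof -
    obtain j where "j < n" "apply_bcontfun (add_mult_tuple n f y g j) x \<noteq> 0"
      using y unfolding inv_tuples_bcontfun_iff[OF compact] by blast
    then show ?thesis
      by (intro exI[of _ j]) (simp add: add_mult_tuple_def h_def)
  qed
  have M: "0 < M x" for x
  proof -
    obtain j where "j < n" "apply_bcontfun (h j) x \<noteq> 0"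
      using h_nz by blast
    then show ?thesis
      unfolding M_def by (intro sum_pos2[where i = j]) auto
  qed
  then have M0: "M x \<noteq> 0" for x
    by (metis less_irrefl)
  have contM: "continuous_on UNIV M"
    unfolding M_def by (intro continuous_intros)
  \<comment> \<open>Where \<open>N x \<ge> d\<close>, \<open>g\<close> vanishes, so \<open>h\<close>
    equals \<open>f\<close>, \<open>M\<close> equals \<open>N\<close> and the factor is 1. Elsewhere
    the factor is \<open>d / M x\<close>, which bounds each entry of \<open>u\<close> by
    \<open>d\<close>, while those of \<open>f\<close> are below \<open>d\<close> as well.\<close>
  define u where "u = (\<lambda>j\<in>{..<n}. Bcontfun (\<lambda>x. (max d (N x) / M x) *\<^sub>R apply_bcontfun (h j) x))"
  have u: "apply_bcontfun (u j) x = (max d (N x) / M x) *\<^sub>R apply_bcontfun (h j) x" if "j < n" for j x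
    using that unfolding u_def restrict_def
    by (subst if_P, simp, subst apply_Bcontfun_compact[OF compact])
      (auto intro!: continuous_intros contN contM simp: M0)
  have "u \<in> inv_tuples n"
    unfolding inv_tuples_bcontfun_iff[OF compact]
  proof (intro conjI allI)
    show "u \<in> tuples n"
      by (simp add: u_def tuples_def)
    fix x
    obtain j where "j < n" "apply_bcontfun (h j) x \<noteq> 0"
      using h_nz by blast
    then show "\<exists>j<n. apply_bcontfun (u j) x \<noteq> 0"
      using d M0 by (intro exI[of _ j]) (auto simp: u)
  qed
  moreover have "dist (u j) (f j) < e" if j: "j < n" for j
  proof -
    have "norm (u j - f j) \<le> 2 * d"
    proof (rule norm_bound)
      fix x
      show "norm (apply_bcontfun (u j - f j) x) \<le> 2 * d"
      proof (cases "d \<le> N x")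
        case True
        then have hf: "apply_bcontfun (h i) x = apply_bcontfun (f i) x" for i
          by (simp add: h_def g)
        then have "M x = N x"
          by (simp add: M_def N_def)
        then show ?thesis
          using True d j by (simp add: u hf max_def)
      next
        case False
        have "norm (apply_bcontfun (h j) x) \<le> M x"
          unfolding M_def using j by (intro member_le_sum) auto
        then have "norm (apply_bcontfun (u j) x) \<le> d"
          using False d M[of x] j by (simp add: u field_simps max_def)
        moreover have "norm (apply_bcontfun (f j) x) \<le> N x"
          unfolding N_def using j by (intro member_le_sum) auto
        ultimately show ?thesis
          using False norm_triangle_ineq4[of "apply_bcontfun (u j) x" "apply_bcontfun (f j) x"]
          by simp
      qed
    qed
    then show ?thesis
      using e by (simp add: dist_norm d_def)
  qed
  ultimately show ?thesis
    by blast
qed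

lemma dense_imp_norm_one:
  fixes f :: "nat \<Rightarrow> 'a::topological_space \<Rightarrow>\<^sub>C 'b::real_normed_field" and g :: "'a \<Rightarrow>\<^sub>C 'b"
  assumes compact: "compact (UNIV :: 'a set)"
    and dense: "\<forall>f\<in>tuples n. \<forall>e>0. \<exists>u\<in>inv_tuples n. \<forall>j<n. dist (u j :: 'a \<Rightarrow>\<^sub>C 'b) (f j) < e"
    and f: "f \<in> tuples n" and fg: "f(n := g) \<in> inv_tuples (n + 1)"
  shows "\<exists>c \<in> tuples n. (\<forall>j<n. norm (c j) = 1) \<and> add_mult_tuple n f c g \<in> inv_tuples n"
proof -
  define N where "N x = (\<Sum>j<n. norm (apply_bcontfun (f j) x))" for x
  have "0 < N x + norm (apply_bcontfun g x)" for x
  proof (cases "apply_bcontfun g x = 0")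
    case True
    then obtain j where "j < n" "apply_bcontfun (f j) x \<noteq> 0"
      using fg inv_tuples_Suc_bcontfun_iff[OF compact f] by blast
    then have "0 < N x"
      unfolding N_def by (intro sum_pos2[where i = j]) auto
    then show ?thesis
      by (simp add: add_pos_nonneg)
  qed (auto simp: N_def intro!: add_nonneg_pos sum_nonneg)
  moreover have "continuous_on UNIV (\<lambda>x. N x + norm (apply_bcontfun g x))"
    unfolding N_def by (intro continuous_intros)
  ultimately obtain m where m: "0 < m" "\<And>x. m \<le> N x + norm (apply_bcontfun g x)"
    by (blast intro: positive_continuous_bounded_below[OF compact])
  \<comment> \<open>Chosen so that \<open>N x \<le> n * d\<close> and
    \<open>norm (g x) \<le> d\<close> together contradict the lower bound \<open>m\<close>.\<close>
  define d where "d = m / (real n + 2)"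
  have d: "0 < d"
    using m(1) by (simp add: d_def add_nonneg_pos)
  have "d * (real n + 2) = m"
    by (simp add: d_def add_eq_0_iff)
  then have md: "m = real n * d + 2 * d"
    by (simp add: algebra_simps)
  \<comment> \<open>Where \<open>g\<close> is small, any multipliers of norm at most 1 leave the
    tuple zero-free. This serves both for \<open>y\<close> and for its later modification
    \<open>c\<close>.\<close>
  have near_zeros: "\<exists>j<n. apply_bcontfun (f j) x + v j * apply_bcontfun g x \<noteq> 0"
    if gx: "norm (apply_bcontfun g x) \<le> d" and v: "\<And>j. j < n \<Longrightarrow> norm (v j) \<le> 1" for v x
  proof (rule ccontr)
    assume "\<not> ?thesis"
    then have "norm (apply_bcontfun (f j) x) = norm (v j) * norm (apply_bcontfun g x)" if "j < n" for j
      using that by (metis add_eq_0_iff norm_minus_cancel norm_mult)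
    then have "norm (apply_bcontfun (f j) x) \<le> d" if "j < n" for j
      using that v[OF that] gx mult_mono[of "norm (v j)" 1 "norm (apply_bcontfun g x)" d] by simp
    then have "N x \<le> real n * d"
      unfolding N_def using sum_bounded_above[of "{..<n}" "\<lambda>j. norm (apply_bcontfun (f j) x)" d] by simp
    then show False
      using m(2)[of x] gx d md by simp
  qed
  \<comment> \<open>Accuracy \<open>d / 2\<close> instead of \<open>d\<close> makes the norm of
    \<open>y\<close> strictly less than 1, as \<open>ex_scale_norm_eq_one\<close> requires.\<close>
  obtain w where w: "w \<in> inv_tuples n" "\<And>j. j < n \<Longrightarrow> dist (w j) (f j) < d / 2"
    using dense f d by (metis half_gt_zero)
  \<comment> \<open>A continuous substitute for \<open>(w j - f j) / g\<close>: the two agree where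
    \<open>norm (g x) \<ge> d\<close>, and the maximum keeps the denominator positive
    elsewhere.\<close>
  define y where "y j = Bcontfun (\<lambda>x. inverse (max (d\<^sup>2) ((norm (apply_bcontfun g x))\<^sup>2)) *\<^sub>R
    (apply_bcontfun (w j - f j) x * normed_conj (apply_bcontfun g x)))" for j
  have max_nz: "max (d\<^sup>2) ((norm (apply_bcontfun g x))\<^sup>2) \<noteq> 0" for x
    using d by (auto simp: max_def)
  have y: "apply_bcontfun (y j) x = inverse (max (d\<^sup>2) ((norm (apply_bcontfun g x))\<^sup>2)) *\<^sub>R
    (apply_bcontfun (w j - f j) x * normed_conj (apply_bcontfun g x))" for j x
    unfolding y_def using max_nz
    by (subst apply_Bcontfun_compact[OF compact]) (auto intro!: continuous_intros simp del: minus_bcontfun.rep_eq)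
  have norm_y: "norm (y j) \<le> 1 / 2" if j: "j < n" for j
  proof (rule norm_bound)
    fix x
    define t where "t = norm (apply_bcontfun g x)"
    have "norm (apply_bcontfun (w j - f j) x) \<le> d / 2"
      using w(2)[OF j] norm_bounded[of "w j - f j" x] by (simp add: dist_norm)
    then have "norm (apply_bcontfun (w j - f j) x) * t \<le> d / 2 * t"
      by (intro mult_right_mono) (auto simp: t_def)
    also have "d * t \<le> max (d\<^sup>2) (t\<^sup>2)"
    proof (cases "t \<le> d")
      case True
      then have "d * t \<le> d * d"
        using d by (intro mult_left_mono) auto
      then show ?thesis
        by (simp add: power2_eq_square)
    next
      case False
      then have "d * t \<le> t * t"
        using d by (intro mult_right_mono) auto
      then show ?thesis
        by (simp add: power2_eq_square)
    qed
    then have "d / 2 * t \<le> max (d\<^sup>2) (t\<^sup>2) / 2"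
      by simp
    finally have bound: "norm (apply_bcontfun (w j - f j) x) * t \<le> max (d\<^sup>2) (t\<^sup>2) / 2" .
    have "norm (apply_bcontfun (y j) x) = norm (apply_bcontfun (w j - f j) x) * t / max (d\<^sup>2) (t\<^sup>2)"
      unfolding y by (simp add: norm_mult t_def divide_inverse abs_if)
    also have "\<dots> \<le> 1 / 2"
      using bound d by (subst pos_divide_le_eq) (auto simp: max.strict_coboundedI1)
    finally show "norm (apply_bcontfun (y j) x) \<le> 1 / 2" .
  qed
  have norm_yx: "norm (apply_bcontfun (y j) x) \<le> 1" if "j < n" for j x
    using norm_bounded[of "y j" x] norm_y[OF that] by simp
  define u where "u j = f j + y j * g" for j
  have u_eq_w: "apply_bcontfun (u j) x = apply_bcontfun (w j) x" if "d < norm (apply_bcontfun g x)" for j x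
  proof -
    have "max (d\<^sup>2) ((norm (apply_bcontfun g x))\<^sup>2) = (norm (apply_bcontfun g x))\<^sup>2"
      using that d by (intro max_absorb2 power_mono) auto
    moreover have "apply_bcontfun g x \<noteq> 0"
      using that d by auto
    ultimately show ?thesis
      by (simp add: u_def y mult.assoc normed_conj_mult scaleR_conv_of_real) (simp add: field_simps)
  qed
  have u_nz: "\<exists>j<n. apply_bcontfun (u j) x \<noteq> 0" for x
  proof (cases "norm (apply_bcontfun g x) \<le> d")
    case True
    then show ?thesis
      using near_zeros norm_yx by (simp add: u_def)
  next
    case False
    then show ?thesis
      using w(1) u_eq_w by (auto simp: inv_tuples_bcontfun_iff[OF compact])
  qed
  have suffices: ?thesis
    if c: "\<And>j. j < n \<Longrightarrow> norm (c j) = 1" "\<And>x. \<exists>j<n. apply_bcontfun (f j + c j * g) x \<noteq> 0" for c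
  proof (intro bexI conjI allI impI)
    have "add_mult_tuple n f (restrict c {..<n}) g = (\<lambda>j\<in>{..<n}. f j + c j * g)"
      by (auto simp: add_mult_tuple_def)
    moreover have "\<exists>j<n. apply_bcontfun ((\<lambda>j\<in>{..<n}. f j + c j * g) j) x \<noteq> 0" for x
      using c(2)[of x] by force
    ultimately show "add_mult_tuple n f (restrict c {..<n}) g \<in> inv_tuples n"
      by (simp add: inv_tuples_bcontfun_iff[OF compact] tuples_def del: restrict_apply)
  qed (auto simp: c(1) tuples_def)
  show ?thesis
  proof (cases "\<exists>p. apply_bcontfun g p = 0")
    case True
    then obtain p where p: "apply_bcontfun g p = 0"
      by blast
    \<comment> \<open>A cutoff equal to 1 on the zeros of \<open>g\<close> and to 0 where
      \<open>norm (g x) \<ge> d\<close>. The convex combination \<open>c\<close> of \<open>y\<close>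
      and 1 therefore stays in the unit ball and takes the value 1 at \<open>p\<close>, so its norm
      is exactly 1.\<close>
    define q where "q x = max 0 (1 - norm (apply_bcontfun g x) / d)" for x
    have q: "0 \<le> q x" "q x \<le> 1" for x
      using d by (auto simp: q_def)
    have contq: "continuous_on UNIV q"
      using d unfolding q_def by (auto intro!: continuous_intros)
    define c where "c j = Bcontfun (\<lambda>x. (1 - q x) *\<^sub>R apply_bcontfun (y j) x + of_real (q x))" for j
    have c: "apply_bcontfun (c j) x = (1 - q x) *\<^sub>R apply_bcontfun (y j) x + of_real (q x)" for j x
      unfolding c_def by (subst apply_Bcontfun_compact[OF compact]) (auto intro!: continuous_intros contq)
    have norm_cx: "norm (apply_bcontfun (c j) x) \<le> 1" if "j < n" for j x
    proof -
      have "norm (apply_bcontfun (c j) x) \<le> (1 - q x) * norm (apply_bcontfun (y j) x) + q x"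
        unfolding c using q[of x] by (intro norm_triangle_le) simp
      also have "(1 - q x) * norm (apply_bcontfun (y j) x) \<le> (1 - q x) * 1"
        using q norm_yx[OF that] by (intro mult_left_mono) auto
      finally show ?thesis
        by simp
    qed
    show ?thesis
    proof (rule suffices)
      fix j
      assume "j < n"
      then have "norm (c j) \<le> 1"
        by (intro norm_bound norm_cx)
      moreover have "apply_bcontfun (c j) p = 1"
        by (simp add: c q_def p)
      then have "1 \<le> norm (c j)"
        using norm_bounded[of "c j" p] by simp
      ultimately show "norm (c j) = 1"
        by simp
    next
      fix x
      show "\<exists>j<n. apply_bcontfun (f j + c j * g) x \<noteq> 0"
      proof (cases "norm (apply_bcontfun g x) \<le> d")
        case True
        then show ?thesis
          using near_zeros norm_cx by simp
      next
        case False
        then have "q x = 0"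
          using d by (simp add: q_def field_simps)
        then show ?thesis
          using u_nz[of x] by (simp add: c u_def)
      qed
    qed
  next
    case False
    then have g_nz: "apply_bcontfun g x \<noteq> 0" for x
      by blast
    define k where "k = Bcontfun (\<lambda>x. inverse (apply_bcontfun g x))"
    have k: "apply_bcontfun k x = inverse (apply_bcontfun g x)" for x
      unfolding k_def by (subst apply_Bcontfun_compact[OF compact]) (auto intro!: continuous_intros simp: g_nz)
    have kg: "k * g = 1"
      by (rule bcontfun_eqI) (simp add: k g_nz)
    \<comment> \<open>The direction \<open>u j * k\<close> gives \<open>v j * g = u j\<close>, so
      moving along it only rescales \<open>u j\<close>. If \<open>u j = 0\<close> this direction
      would vanish; the default 1 still allows the norm to be adjusted, and is harmless because
      zero-freeness at a point is witnessed by an index with \<open>u j\<close> nonzero.\<close>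
    define v where "v j = (if u j = 0 then 1 else u j * k)" for j
    have "v j \<noteq> 0" for j
      using kg by (auto simp: v_def) (metis mult.assoc mult.right_neutral mult_zero_left)
    then have "\<exists>s\<ge>0. norm (y j + s *\<^sub>R v j) = 1" if "j < n" for j
      using norm_y[OF that] by (intro ex_scale_norm_eq_one) auto
    then obtain s where s: "\<And>j. j < n \<Longrightarrow> 0 \<le> s j" "\<And>j. j < n \<Longrightarrow> norm (y j + s j *\<^sub>R v j) = 1"
      by metis
    show ?thesis
    proof (rule suffices)
      fix x
      obtain j where j: "j < n" "apply_bcontfun (u j) x \<noteq> 0"
        using u_nz by blast
      then have "u j \<noteq> 0"
        by auto
      then have "f j + (y j + s j *\<^sub>R v j) * g = (1 + s j) *\<^sub>R u j"
        by (simp add: v_def distrib_right mult.assoc kg scaleR_left_distrib flip: add.assoc) (simp add: u_def)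
      then have "apply_bcontfun (f j + (y j + s j *\<^sub>R v j) * g) x = (1 + s j) *\<^sub>R apply_bcontfun (u j) x"
        by (metis scaleR_bcontfun.rep_eq)
      then show "\<exists>j<n. apply_bcontfun (f j + (y j + s j *\<^sub>R v j) * g) x \<noteq> 0"
        using j s(1)[OF j(1)] by (intro exI[of _ j]) auto
    qed (rule s(2))
  qed
qed

section \<open>Equality of the three ranks\<close>

theorem stable_ranks_bcontfun_eq:
  assumes compact: "compact (UNIV :: 'a::topological_space set)"
  shows "bsr TYPE('a \<Rightarrow>\<^sub>C 'b::real_normed_field) = tsr TYPE('a \<Rightarrow>\<^sub>C 'b)"
    and "tsr TYPE('a \<Rightarrow>\<^sub>C 'b) = nor TYPE('a \<Rightarrow>\<^sub>C 'b)"
proof -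
  let ?B = "\<lambda>n. \<forall>f \<in> tuples n. \<forall>g::'a \<Rightarrow>\<^sub>C 'b. f(n := g) \<in> inv_tuples (n + 1) \<longrightarrow>
     (\<exists>x \<in> tuples n. add_mult_tuple n f x g \<in> inv_tuples n)"
  let ?T = "\<lambda>n. product_topology (\<lambda>_. euclidean) {..<n} closure_of
     (inv_tuples n :: (nat \<Rightarrow> 'a \<Rightarrow>\<^sub>C 'b) set) = tuples n"
  let ?N = "\<lambda>n. \<forall>f \<in> tuples n. \<forall>g::'a \<Rightarrow>\<^sub>C 'b. f(n := g) \<in> inv_tuples (n + 1) \<longrightarrow>
     (\<exists>c \<in> tuples n. (\<forall>j<n. norm (c j) = 1) \<and> add_mult_tuple n f c g \<in> inv_tuples n)"
  have T: "?T n \<longleftrightarrow> (\<forall>f\<in>tuples n. \<forall>e>0. \<exists>u\<in>inv_tuples n. \<forall>j<n. dist (u j :: 'a \<Rightarrow>\<^sub>C 'b) (f j) < e)" for n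
    by (rule closure_of_tuples_eq_iff) (auto simp: inv_tuples_def)
  have BT: "?T n" if "?B n" for n
    unfolding T using bass_imp_dense[OF compact that] by blast
  have TN: "?N n" if "?T n" for n
    using dense_imp_norm_one[OF compact that[unfolded T]] by blast
  \<comment> \<open>A norm-one solution is in particular a Bass solution, which closes the cycle of
    implications.\<close>
  have NB: "?B n" if "?N n" for n
    using that by meson
  show "bsr TYPE('a \<Rightarrow>\<^sub>C 'b) = tsr TYPE('a \<Rightarrow>\<^sub>C 'b)"
    unfolding bsr_def tsr_def using BT TN NB by (intro least_rank_cong) blast
  show "tsr TYPE('a \<Rightarrow>\<^sub>C 'b) = nor TYPE('a \<Rightarrow>\<^sub>C 'b)"
    unfolding tsr_def nor_def using BT TN NB by (intro least_rank_cong) blast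
qed

theorem theorem2p5:
  assumes "compact (UNIV :: 'a::t2_space set)"
  shows "bsr TYPE('a \<Rightarrow>\<^sub>C real) = tsr TYPE('a \<Rightarrow>\<^sub>C real) \<and>
         tsr TYPE('a \<Rightarrow>\<^sub>C real) = nor TYPE('a \<Rightarrow>\<^sub>C real) \<and>
         bsr TYPE('a \<Rightarrow>\<^sub>C complex) = tsr TYPE('a \<Rightarrow>\<^sub>C complex) \<and>
         tsr TYPE('a \<Rightarrow>\<^sub>C complex) = nor TYPE('a \<Rightarrow>\<^sub>C complex)"
  by (intro conjI stable_ranks_bcontfun_eq assms)

end
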